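(* Let $G$ be a finite simple undirected graph with nonempty vertex set. Then $G$ is the niche graph of a semiorder if and only if $G$ is (isomorphic to) one of the following graphs, for some positive integers $m$, $n$, $q$: (i) an edgeless graph $I_q$; (ii) the union of two complete graphs $K_m \cup K_n$; (iii) the union of two complete graphs and an edgeless graph $K_m \cup K_n \cup I_q$; (iv) the complement of the union of a complete bipartite graph and an edgeless graph, $\overline{K_{m,n} \cup I_q}$.
   Context: All graphs and digraphs are finite with nonempty vertex set; graphs are simple and undirected. For a digraph $D=(V,A)$ with vertex set $V(D)=V$ and arc set $A(D)=A$, and $x \in V$, let $N^+_D(x)=\{v \in V \mid (x,v)\in A\}$ and $N^-_D(x)=\{v\in V \mid (v,x)\in A\}$ be the sets of out-neighbors and in-neighbors of $x$. The niche graph of $D$ is the graph with the same vertex set as $D$ in which two distinct vertices $x$ and $y$ are adjacent if and only if $N^+_D(x)\cap N^+_D(y)\neq\emptyset$ or $N^-_D(x)\cap N^-_D(y)\neq\emptyset$. A digraph $D=(V,A)$ is a semiorder (or unit interval order) if there exist a function $f:V\to\mathbb{R}$ and a positive real number $\delta$ such that, for all $x,y\in V$, $(x,y)\in A$ if and only if $f(x)>f(y)+\delta$. $K_n$ denotes the complete graph with $n$ vertices; $I_n$ denotes the edgeless graph with $n$ vertices; $K_{m,n}$ denotes the complete bipartite graph with partite sets of sizes $m$ and $n$. $G\cup H$ denotes the disjoint union of graphs $G$ and $H$. $\overline{G}$ denotes the complement of $G$ (same vertex set, two distinct vertices adjacent in $\overline{G}$ if and only if they are not adjacent in $G$). *)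

theory Defs
  imports Complex_Main "Graph_Theory.Graph_Theory"
begin

(* Undirected simple graphs are loopless symmetric digraphs (locale pair_graph), each edge being a
   pair of opposite arcs. *)

definition out_nbrs :: "'a pair_pre_digraph \<Rightarrow> 'a \<Rightarrow> 'a set" where
  "out_nbrs D x = {v \<in> pverts D. (x, v) \<in> parcs D}"

definition in_nbrs :: "'a pair_pre_digraph \<Rightarrow> 'a \<Rightarrow> 'a set" where
  "in_nbrs D x = {v \<in> pverts D. (v, x) \<in> parcs D}"

definition niche_graph :: "'a pair_pre_digraph \<Rightarrow> 'a pair_pre_digraph" where
  "niche_graph D = \<lparr> pverts = pverts D,
     parcs = {(x, y). x \<in> pverts D \<and> y \<in> pverts D \<and> x \<noteq> y \<and>
       (out_nbrs D x \<inter> out_nbrs D y \<noteq> {} \<or> in_nbrs D x \<inter> in_nbrs D y \<noteq> {})} \<rparr>"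

definition semiorder :: "'a pair_pre_digraph \<Rightarrow> bool" where
  "semiorder D \<longleftrightarrow> (\<exists>(f :: 'a \<Rightarrow> real) (\<delta> :: real). \<delta> > 0 \<and>
     (\<forall>x \<in> pverts D. \<forall>y \<in> pverts D. (x, y) \<in> parcs D \<longleftrightarrow> f x > f y + \<delta>))"

(* Edgeless counterpart of complete_digraph and complete_bipartite_digraph: a predicate that is
   closed under isomorphism. *)
definition edgeless_digraph :: "nat \<Rightarrow> ('a, 'b) pre_digraph \<Rightarrow> bool" (\<open>I\<^bsub>_\<^esub>\<close>) where
  "edgeless_digraph q G \<longleftrightarrow> graph G \<and> card (verts G) = q \<and> arcs_ends G = {}"

(* The library's union identifies shared vertices; here the two sides are kept apart by tagging. *)
definition disjoint_union ::
  "'a pair_pre_digraph \<Rightarrow> 'b pair_pre_digraph \<Rightarrow> ('a + 'b) pair_pre_digraph" (infixl \<open>\<uplus>\<close> 65) where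
  "G \<uplus> H = \<lparr> pverts = pverts G <+> pverts H,
     parcs = map_prod Inl Inl ` parcs G \<union> map_prod Inr Inr ` parcs H \<rparr>"

definition graph_complement :: "'a pair_pre_digraph \<Rightarrow> 'a pair_pre_digraph" where
  "graph_complement G = \<lparr> pverts = pverts G,
     parcs = {(x, y). x \<in> pverts G \<and> y \<in> pverts G \<and> x \<noteq> y \<and> (x, y) \<notin> parcs G} \<rparr>"

end

theory Submission
  imports Defs
begin

text \<open>
  Let \<open>f\<close> and \<open>\<delta>\<close> represent a semiorder. Fix a vertex at which \<open>f\<close> is least: it is an
  out-neighbour of every vertex that has any out-neighbour. Dually, a vertex at which \<open>f\<close> is greatest
  is an in-neighbour of every vertex that has any in-neighbour. Hence the set \<open>U\<close> of vertices that have out-neighbours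
  and the set \<open>W\<close> of vertices that have in-neighbours are cliques of the niche graph, and these
  two cliques contain every edge (\<open>semiorder_niche_adjacency\<close>).

  If \<open>U\<close> and \<open>W\<close> are disjoint, the graph consists of two disjoint cliques and isolated vertices;
  both cliques are nonempty as soon as there is an arc. If some \<open>z\<close> lies in \<open>U \<inter> W\<close>, then every
  vertex lies in \<open>U \<union> W\<close>: a vertex above \<open>z\<close> beats whatever \<open>z\<close> beats, and any other vertex loses
  to whatever \<open>z\<close> loses to. The only missing edges are then those between \<open>U - W\<close> and \<open>W - U\<close>, so
  the complement is complete bipartite plus isolated vertices. Both parts are nonempty, as they
  contain the extreme vertices; this is why a complete graph with at least two vertices is not
  a niche graph of a semiorder.

  In all cases the graph is described by the label \<open>Upper\<close> on \<open>U - W\<close>, \<open>Lower\<close> on \<open>W - U\<close>, and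
  \<open>Middle\<close> elsewhere, together with a relation saying which labels are adjacent: \<open>clustered\<close> for
  the first three families and \<open>linked\<close> for the fourth. A graph of this shape is determined up to
  isomorphism by the number of vertices with each label, which turns each family into a condition
  on these numbers. Conversely the labels, read as heights \<open>2\<close>, \<open>1\<close>, \<open>0\<close>, represent a semiorder
  with the given niche graph: the threshold \<open>\<delta> = 1\<close> yields only the arcs from \<open>Upper\<close> to
  \<open>Lower\<close>, and \<open>\<delta> = 1/2\<close> yields the arcs between any two different heights.
\<close>

section \<open>Graphs given by a vertex labelling\<close>

text \<open>
  Adjacency of distinct vertices depends only on their labels. Vertices with the same label are
  thus twins, forming a clique or an independent set according to whether \<open>R\<close> relates the label to
  itself.
\<close>
definition blowup_of :: "('l \<Rightarrow> 'l \<Rightarrow> bool) \<Rightarrow> ('a \<Rightarrow> 'l) \<Rightarrow> 'a pair_pre_digraph \<Rightarrow> bool" where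
  "blowup_of R c G \<longleftrightarrow>
     parcs G = {(x, y). x \<in> pverts G \<and> y \<in> pverts G \<and> x \<noteq> y \<and> R (c x) (c y)}"

definition fibre :: "('a \<Rightarrow> 'l) \<Rightarrow> 'a pair_pre_digraph \<Rightarrow> 'l \<Rightarrow> 'a set" where
  "fibre c G l = {x \<in> pverts G. c x = l}"

definition blowup_sizes :: "('l \<Rightarrow> 'l \<Rightarrow> bool) \<Rightarrow> ('l \<Rightarrow> nat) \<Rightarrow> 'a pair_pre_digraph \<Rightarrow> bool" where
  "blowup_sizes R k G \<longleftrightarrow>
     finite (pverts G) \<and> (\<exists>c. blowup_of R c G \<and> (\<forall>l. card (fibre c G l) = k l))"

text \<open>
  An isomorphism record acts separately on vertices and on arcs; for graphs whose arcs are pairs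
  the vertex map alone carries all the information.
\<close>
lemma digraph_iso_pairD:
  assumes "digraph_iso (with_proj G) (with_proj H)"
  obtains h where "bij_betw h (pverts G) (pverts H)" "parcs H = map_prod h h ` parcs G"
proof -
  from assms obtain f where f: "pre_digraph.digraph_isomorphism (with_proj G) f"
    "with_proj H = app_iso f (with_proj G)"
    unfolding digraph_iso_def by auto
  let ?h = "iso_verts f"
  have "bij_betw ?h (pverts G) (pverts H)"
    using pre_digraph.digraph_isomorphism_inj_on_verts[OF f(1)] arg_cong[OF f(2), of verts]
    by (auto simp: bij_betw_def)
  moreover have "parcs H = map_prod ?h ?h ` parcs G"
    using arg_cong[OF f(2), of arcs_ends] wf_digraph.arcs_ends_app_iso_eq[OF _ f(1)] f(1)
    by (simp add: map_prod_def pre_digraph.digraph_isomorphism_def)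
  ultimately show thesis by (rule that)
qed

text \<open>
  Arcs are pairs of vertices, so the action of an isomorphism on arcs is forced by its action on
  vertices.
\<close>
lemma digraph_iso_pairI:
  assumes "pair_wf_digraph G" "bij_betw h (pverts G) (pverts H)"
    and "parcs H = map_prod h h ` parcs G"
  shows "digraph_iso (with_proj G) (with_proj H)"
proof -
  interpret pair_wf_digraph G by fact
  let ?f = "\<lparr>iso_verts = h, iso_arcs = map_prod h h, iso_head = snd, iso_tail = fst\<rparr>"
  have "inj_on h (pverts G)" using assms(2) by (rule bij_betw_imp_inj_on)
  then have "inj_on (map_prod h h) (pverts G \<times> pverts G)" by (blast intro: map_prod_inj_on)
  then have "inj_on (map_prod h h) (parcs G)"
    by (rule inj_on_subset) (auto dest: in_arcsD1 in_arcsD2)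
  then have "pre_digraph.digraph_isomorphism (with_proj G) ?f"
    using \<open>inj_on h (pverts G)\<close> wf_digraph by (simp add: pre_digraph.digraph_isomorphism_def)
  moreover have "with_proj H = app_iso ?f (with_proj G)"
    using assms(2,3) by (simp add: with_proj_def app_iso_def bij_betw_def)
  ultimately show ?thesis unfolding digraph_iso_def by blast
qed

lemma blowup_sizes_iso_pullback:
  assumes "pair_fin_digraph G" "digraph_iso (with_proj G) (with_proj H)" "blowup_sizes R k H"
  shows "blowup_sizes R k G"
proof -
  interpret pair_fin_digraph G by fact
  obtain c where c: "blowup_of R c H" "\<And>l. card (fibre c H l) = k l"
    using assms(3) unfolding blowup_sizes_def by blast
  obtain h where h: "bij_betw h (pverts G) (pverts H)" "parcs H = map_prod h h ` parcs G"
    using assms(2) by (rule digraph_iso_pairD)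
  have inj: "inj_on h (pverts G)" and im: "h ` pverts G = pverts H"
    using h(1) by (auto simp: bij_betw_def)
  have arc_iff: "(x, y) \<in> parcs G \<longleftrightarrow> (h x, h y) \<in> parcs H" if "x \<in> pverts G" "y \<in> pverts G" for x y
    using that inj unfolding h(2) by (auto dest: inj_onD in_arcsD1 in_arcsD2)
  have "(x, y) \<in> parcs G \<longleftrightarrow> x \<noteq> y \<and> R (c (h x)) (c (h y))"
    if "x \<in> pverts G" "y \<in> pverts G" for x y
    using arc_iff[OF that] c(1) inj_on_eq_iff[OF inj that] imageI[OF that(1), of h]
      imageI[OF that(2), of h] im by (simp add: blowup_of_def)
  then have "blowup_of R (c \<circ> h) G"
    unfolding blowup_of_def comp_def by (blast dest: in_arcsD1 in_arcsD2)
  moreover have "card (fibre (c \<circ> h) G l) = card (fibre c H l)" for l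
  proof (rule bij_betw_same_card)
    show "bij_betw h (fibre (c \<circ> h) G l) (fibre c H l)"
      using inj im unfolding fibre_def bij_betw_def by (auto simp: inj_on_def)
  qed
  ultimately show ?thesis
    unfolding blowup_sizes_def using pair_finite_verts c(2) by metis
qed

text \<open>
  Any bijections between corresponding fibres glue to an isomorphism, as adjacency is read off from
  the labels.
\<close>
lemma digraph_iso_if_same_blowup_sizes:
  assumes "blowup_sizes R k G" "blowup_sizes R k H"
  shows "digraph_iso (with_proj G) (with_proj H)"
proof -
  obtain c where fin_G: "finite (pverts G)" and c: "blowup_of R c G" "\<And>l. card (fibre c G l) = k l"
    using assms(1) unfolding blowup_sizes_def by blast
  obtain d where fin_H: "finite (pverts H)" and d: "blowup_of R d H" "\<And>l. card (fibre d H l) = k l"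
    using assms(2) unfolding blowup_sizes_def by blast
  have "\<exists>g. bij_betw g (fibre c G l) (fibre d H l)" for l
    using fin_G fin_H c(2) d(2) by (intro finite_same_card_bij) (auto simp: fibre_def)
  then obtain g where g: "\<And>l. bij_betw (g l) (fibre c G l) (fibre d H l)" by metis
  define h where "h x = g (c x) x" for x
  have h_mem: "h x \<in> pverts H \<and> d (h x) = c x" if "x \<in> pverts G" for x
    using bij_betw_apply[OF g[of "c x"], of x] that by (simp add: h_def fibre_def)
  have "inj_on h (pverts G)"
  proof (rule inj_onI)
    fix x y assume "x \<in> pverts G" "y \<in> pverts G" "h x = h y"
    moreover from this have "c x = c y" using h_mem by metis
    ultimately show "x = y"
      using bij_betw_imp_inj_on[OF g[of "c x"]] by (auto simp: h_def fibre_def dest: inj_onD)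
  qed
  moreover have "h ` pverts G = pverts H"
  proof (intro equalityI subsetI)
    fix y assume "y \<in> pverts H"
    then have "y \<in> g (d y) ` fibre c G (d y)"
      using bij_betw_imp_surj_on[OF g[of "d y"]] by (auto simp: fibre_def)
    then show "y \<in> h ` pverts G" by (force simp: h_def fibre_def)
  qed (use h_mem in auto)
  ultimately have bij: "bij_betw h (pverts G) (pverts H)" by (simp add: bij_betw_def)
  have "parcs H = map_prod h h ` parcs G"
  proof (intro equalityI subsetI)
    fix e assume "e \<in> parcs H"
    then obtain x y where "x \<in> pverts G" "y \<in> pverts G" "e = (h x, h y)"
      "h x \<noteq> h y" "R (d (h x)) (d (h y))"
      using d(1) \<open>h ` pverts G = pverts H\<close>[symmetric] unfolding blowup_of_def by auto
    then have "(x, y) \<in> parcs G" using c(1) h_mem unfolding blowup_of_def by auto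
    then show "e \<in> map_prod h h ` parcs G" using \<open>e = (h x, h y)\<close> by auto
  next
    fix e assume "e \<in> map_prod h h ` parcs G"
    then show "e \<in> parcs H"
      using c(1) d(1) h_mem inj_on_eq_iff[OF \<open>inj_on h (pverts G)\<close>] unfolding blowup_of_def
      by auto
  qed
  moreover have "pair_wf_digraph G"
    using c(1) by (auto simp: blowup_of_def pair_wf_digraph_def)
  ultimately show ?thesis using bij digraph_iso_pairI by blast
qed

text \<open>
  The relation and the sizes determine a graph up to isomorphism, so it does not matter which
  representatives the class contains.
\<close>
lemma iso_to_blowup_class_iff:
  assumes "pair_fin_digraph G" "\<C> \<noteq> {}" "\<And>H. H \<in> \<C> \<Longrightarrow> blowup_sizes R k H"
  shows "(\<exists>H\<in>\<C>. digraph_iso (with_proj G) (with_proj H)) \<longleftrightarrow> blowup_sizes R k G"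
  using assms blowup_sizes_iso_pullback digraph_iso_if_same_blowup_sizes by blast

lemma blowup_of_disjoint_union:
  assumes "blowup_of R c G" "blowup_of R d H"
    and "\<And>x y. x \<in> pverts G \<Longrightarrow> y \<in> pverts H \<Longrightarrow> \<not> R (c x) (d y) \<and> \<not> R (d y) (c x)"
  shows "blowup_of R (case_sum c d) (G \<uplus> H)"
proof -
  have "e \<in> parcs (G \<uplus> H) \<longleftrightarrow> e \<in> {(a, b). a \<in> pverts (G \<uplus> H) \<and> b \<in> pverts (G \<uplus> H) \<and> a \<noteq> b \<and>
      R (case_sum c d a) (case_sum c d b)}" for e
  proof (cases e)
    case (Pair a b)
    show ?thesis unfolding Pair
      using assms
      by (cases a; cases b) (auto simp: disjoint_union_def blowup_of_def)
  qed
  then show ?thesis unfolding blowup_of_def by (rule set_eqI)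
qed

lemma card_fibre_disjoint_union:
  assumes "finite (pverts G)" "finite (pverts H)"
  shows "card (fibre (case_sum c d) (G \<uplus> H) l) = card (fibre c G l) + card (fibre d H l)"
proof -
  have "fibre (case_sum c d) (G \<uplus> H) l = Inl ` fibre c G l \<union> Inr ` fibre d H l"
    by (auto simp: fibre_def disjoint_union_def)
  moreover have "finite (fibre c G l)" "finite (fibre d H l)" using assms by (auto simp: fibre_def)
  moreover have "Inl ` fibre c G l \<inter> Inr ` fibre d H l = {}" by blast
  ultimately show ?thesis by (simp add: card_Un_disjoint card_image)
qed

text \<open>
  The two graphs may use common labels. All that matters is that no label occurring in the first is
  related to one occurring in the second, since a disjoint union has no edges between its sides.
\<close>
lemma blowup_sizes_disjoint_union:
  assumes "blowup_sizes R k G" "blowup_sizes R k' H"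
    and "\<And>a b. k a \<noteq> 0 \<Longrightarrow> k' b \<noteq> 0 \<Longrightarrow> \<not> R a b \<and> \<not> R b a"
  shows "blowup_sizes R (\<lambda>l. k l + k' l) (G \<uplus> H)"
proof -
  obtain c where fin_G: "finite (pverts G)" and c: "blowup_of R c G" "\<And>l. card (fibre c G l) = k l"
    using assms(1) unfolding blowup_sizes_def by blast
  obtain d where fin_H: "finite (pverts H)" and d: "blowup_of R d H" "\<And>l. card (fibre d H l) = k' l"
    using assms(2) unfolding blowup_sizes_def by blast
  have "k (c x) \<noteq> 0" if "x \<in> pverts G" for x
    using that fin_G by (auto simp: c(2)[symmetric] fibre_def)
  moreover have "k' (d y) \<noteq> 0" if "y \<in> pverts H" for y
    using that fin_H by (auto simp: d(2)[symmetric] fibre_def)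
  ultimately have "blowup_of R (case_sum c d) (G \<uplus> H)"
    using assms(3) by (intro blowup_of_disjoint_union c(1) d(1)) blast
  moreover have "finite (pverts (G \<uplus> H))"
    using fin_G fin_H by (simp add: disjoint_union_def)
  ultimately show ?thesis
    unfolding blowup_sizes_def using card_fibre_disjoint_union[OF fin_G fin_H] c(2) d(2) by metis
qed

lemma blowup_sizes_complement:
  assumes "blowup_sizes R k G"
  shows "blowup_sizes (\<lambda>a b. \<not> R a b) k (graph_complement G)"
proof -
  obtain c where "finite (pverts G)" "blowup_of R c G" "\<And>l. card (fibre c G l) = k l"
    using assms unfolding blowup_sizes_def by blast
  then show ?thesis
    unfolding blowup_sizes_def
    by (intro conjI exI[of _ c]) (auto simp: graph_complement_def blowup_of_def fibre_def)
qed

section \<open>The four families as blow-ups of three levels\<close>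

text \<open>
  In the niche graph of a semiorder, \<open>Upper\<close> marks the vertices with out-neighbours only and \<open>Lower\<close>
  those with in-neighbours only. Vertices with both and vertices with neither can share the label
  \<open>Middle\<close>, because the two kinds never occur together.
\<close>
datatype level = Upper | Middle | Lower

text \<open>
  Two disjoint cliques \<open>Upper\<close> and \<open>Lower\<close>, with the \<open>Middle\<close> vertices isolated.
\<close>
definition clustered :: "level \<Rightarrow> level \<Rightarrow> bool" where
  "clustered a b \<longleftrightarrow> a = b \<and> a \<noteq> Middle"

text \<open>
  Two cliques \<open>Upper \<union> Middle\<close> and \<open>Middle \<union> Lower\<close>, overlapping in \<open>Middle\<close>.
\<close>
definition linked :: "level \<Rightarrow> level \<Rightarrow> bool" where
  "linked a b \<longleftrightarrow> a = b \<or> a = Middle \<or> b = Middle"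

lemma clustered_iff: "clustered a b \<longleftrightarrow> a = Upper \<and> b = Upper \<or> a = Lower \<and> b = Lower"
  by (cases a; cases b) (simp_all add: clustered_def)

lemma linked_iff: "linked a b \<longleftrightarrow> \<not> (a = Upper \<and> b = Lower) \<and> \<not> (a = Lower \<and> b = Upper)"
  by (cases a; cases b) (simp_all add: linked_def)

lemma all_level: "(\<forall>l. P l) \<longleftrightarrow> P Upper \<and> P Middle \<and> P Lower"
proof (intro iffI allI)
  fix l assume "P Upper \<and> P Middle \<and> P Lower"
  then show "P l" by (cases l) simp_all
qed simp

lemma edgeless_digraph_pair_def: "I\<^bsub>q\<^esub> (with_proj G) \<longleftrightarrow>
  finite (pverts G) \<and> card (pverts G) = q \<and> parcs G = {}" (is "_ \<longleftrightarrow> ?R")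
proof
  assume A: "I\<^bsub>q\<^esub> (with_proj G)"
  then interpret graph "with_proj G" by (simp only: edgeless_digraph_def)
  show ?R using A finite_verts by (simp add: edgeless_digraph_def)
next
  assume A: ?R
  then interpret pair_graph G by unfold_locales (simp_all add: symmetric_def)
  show "I\<^bsub>q\<^esub> (with_proj G)" using A graph_axioms by (simp add: edgeless_digraph_def)
qed

lemma ex_edgeless_digraph: "\<exists>E :: nat pair_pre_digraph. I\<^bsub>q\<^esub> (with_proj E)"
  by (rule exI[of _ "\<lparr>pverts = {..<q}, parcs = {}\<rparr>"]) (simp add: edgeless_digraph_pair_def)

lemma ex_complete_digraph: "\<exists>A :: nat pair_pre_digraph. K\<^bsub>m\<^esub> (with_proj A)"
  by (rule exI[of _ "\<lparr>pverts = {..<m}, parcs = {(u, v). (u, v) \<in> {..<m} \<times> {..<m} \<and> u \<noteq> v}\<rparr>"])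
    (unfold complete_digraph_pair_def, auto)

lemma ex_complete_bipartite_digraph: "\<exists>C :: nat pair_pre_digraph. K\<^bsub>m,n\<^esub> (with_proj C)"
proof -
  let ?U = "{..<m}" and ?V = "{m..<m + n}"
  have "K\<^bsub>m,n\<^esub> (with_proj \<lparr>pverts = ?U \<union> ?V, parcs = ?U \<times> ?V \<union> ?V \<times> ?U\<rparr>)"
    unfolding complete_bipartite_digraph_pair_def
    by (intro conjI exI[of _ ?U] exI[of _ ?V]) auto
  then show ?thesis by blast
qed

lemma blowup_sizes_complete:
  assumes "K\<^bsub>m\<^esub> (with_proj A)" "R a a"
  shows "blowup_sizes R (\<lambda>l. if l = a then m else 0) A"
  using assms unfolding blowup_sizes_def complete_digraph_pair_def
  by (intro conjI exI[of _ "\<lambda>_. a"]) (auto simp: blowup_of_def fibre_def)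

lemma blowup_sizes_edgeless:
  assumes "I\<^bsub>q\<^esub> (with_proj E)" "\<not> R a a"
  shows "blowup_sizes R (\<lambda>l. if l = a then q else 0) E"
  using assms unfolding blowup_sizes_def edgeless_digraph_pair_def
  by (intro conjI exI[of _ "\<lambda>_. a"]) (auto simp: blowup_of_def fibre_def)

lemma blowup_sizes_complete_bipartite:
  assumes "K\<^bsub>m,n\<^esub> (with_proj C)" "a \<noteq> b" "R a b" "R b a" "\<not> R a a" "\<not> R b b"
  shows "blowup_sizes R (\<lambda>l. if l = a then m else if l = b then n else 0) C"
proof -
  obtain U V where fin: "finite (pverts C)" and UV: "pverts C = U \<union> V" "U \<inter> V = {}"
    "card U = m" "card V = n" and arcs: "parcs C = U \<times> V \<union> V \<times> U"
    using assms(1) unfolding complete_bipartite_digraph_pair_def by blast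
  let ?c = "\<lambda>x. if x \<in> U then a else b"
  have "blowup_of R ?c C"
    using UV(1,2) assms(2-) unfolding blowup_of_def arcs by (auto split: if_splits)
  moreover have "fibre ?c C l = (if l = a then U else if l = b then V else {})" for l
    using UV(1,2) assms(2) by (auto simp: fibre_def)
  ultimately show ?thesis
    using fin UV(3,4) unfolding blowup_sizes_def by (intro conjI exI[of _ ?c]) auto
qed

text \<open>
  In \<open>clustered\<close> the middle level is the independent one, which makes an edgeless graph the case of
  two empty cliques and lets the first three families share one relation.
\<close>
lemma iso_edgeless_iff:
  assumes "pair_fin_digraph G"
  shows "(\<exists>E :: nat pair_pre_digraph. I\<^bsub>q\<^esub> (with_proj E) \<and> digraph_iso (with_proj G) (with_proj E)) \<longleftrightarrow>
    blowup_sizes clustered (case_level 0 q 0) G"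
proof -
  let ?\<C> = "{E :: nat pair_pre_digraph. I\<^bsub>q\<^esub> (with_proj E)}"
  have "(\<exists>E\<in>?\<C>. digraph_iso (with_proj G) (with_proj E)) \<longleftrightarrow>
    blowup_sizes clustered (case_level 0 q 0) G"
  proof (rule iso_to_blowup_class_iff[OF assms])
    fix H assume "H \<in> ?\<C>"
    then have "blowup_sizes clustered (\<lambda>l. if l = Middle then q else 0) H"
      by (intro blowup_sizes_edgeless) (auto simp: clustered_def)
    also have "(\<lambda>l. if l = Middle then q else 0) = case_level 0 q 0"
      by (auto simp: fun_eq_iff split: level.split)
    finally show "blowup_sizes clustered (case_level 0 q 0) H" .
  qed (use ex_edgeless_digraph in auto)
  then show ?thesis by simp
qed

lemma blowup_sizes_two_completes:
  assumes "K\<^bsub>m\<^esub> (with_proj A)" "K\<^bsub>n\<^esub> (with_proj B)"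
  shows "blowup_sizes clustered (case_level m 0 n) (A \<uplus> B)"
proof -
  have "blowup_sizes clustered
      (\<lambda>l. (if l = Upper then m else 0) + (if l = Lower then n else 0)) (A \<uplus> B)"
    using assms
    by (intro blowup_sizes_disjoint_union blowup_sizes_complete)
      (auto simp: clustered_def split: if_splits)
  also have "(\<lambda>l. (if l = Upper then m else 0) + (if l = Lower then n else 0)) = case_level m 0 n"
    by (auto simp: fun_eq_iff split: level.split)
  finally show ?thesis .
qed

lemma iso_two_completes_iff:
  assumes "pair_fin_digraph G"
  shows "(\<exists>(A :: nat pair_pre_digraph) (B :: nat pair_pre_digraph).
      K\<^bsub>m\<^esub> (with_proj A) \<and> K\<^bsub>n\<^esub> (with_proj B) \<and> digraph_iso (with_proj G) (with_proj (A \<uplus> B))) \<longleftrightarrow>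
    blowup_sizes clustered (case_level m 0 n) G"
proof -
  let ?\<C> = "{A \<uplus> B | (A :: nat pair_pre_digraph) (B :: nat pair_pre_digraph).
    K\<^bsub>m\<^esub> (with_proj A) \<and> K\<^bsub>n\<^esub> (with_proj B)}"
  have "(\<exists>H\<in>?\<C>. digraph_iso (with_proj G) (with_proj H)) \<longleftrightarrow>
    blowup_sizes clustered (case_level m 0 n) G"
  proof (rule iso_to_blowup_class_iff[OF assms])
    show "?\<C> \<noteq> {}"
      using ex_complete_digraph[of m] ex_complete_digraph[of n] by blast
  qed (use blowup_sizes_two_completes in blast)
  then show ?thesis by blast
qed

lemma iso_two_completes_edgeless_iff:
  assumes "pair_fin_digraph G"
  shows "(\<exists>(A :: nat pair_pre_digraph) (B :: nat pair_pre_digraph) (E :: nat pair_pre_digraph).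
      K\<^bsub>m\<^esub> (with_proj A) \<and> K\<^bsub>n\<^esub> (with_proj B) \<and> I\<^bsub>q\<^esub> (with_proj E) \<and>
      digraph_iso (with_proj G) (with_proj (A \<uplus> B \<uplus> E))) \<longleftrightarrow>
    blowup_sizes clustered (case_level m q n) G"
proof -
  let ?\<C> = "{A \<uplus> B \<uplus> E | (A :: nat pair_pre_digraph) (B :: nat pair_pre_digraph) (E :: nat pair_pre_digraph).
    K\<^bsub>m\<^esub> (with_proj A) \<and> K\<^bsub>n\<^esub> (with_proj B) \<and> I\<^bsub>q\<^esub> (with_proj E)}"
  have "(\<exists>H\<in>?\<C>. digraph_iso (with_proj G) (with_proj H)) \<longleftrightarrow>
    blowup_sizes clustered (case_level m q n) G"
  proof (rule iso_to_blowup_class_iff[OF assms])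
    fix H assume "H \<in> ?\<C>"
    then obtain A B E :: "nat pair_pre_digraph" where H: "H = A \<uplus> B \<uplus> E"
      and "K\<^bsub>m\<^esub> (with_proj A)" "K\<^bsub>n\<^esub> (with_proj B)" "I\<^bsub>q\<^esub> (with_proj E)" by blast
    then have "blowup_sizes clustered (\<lambda>l. case_level m 0 n l + (if l = Middle then q else 0)) H"
      unfolding H
      by (intro blowup_sizes_disjoint_union blowup_sizes_two_completes blowup_sizes_edgeless)
        (auto simp: clustered_def split: if_splits)
    also have "(\<lambda>l. case_level m 0 n l + (if l = Middle then q else 0)) = case_level m q n"
      by (auto simp: fun_eq_iff split: level.split)
    finally show "blowup_sizes clustered (case_level m q n) H" .
  next
    show "?\<C> \<noteq> {}"
      using ex_complete_digraph[of m] ex_complete_digraph[of n] ex_edgeless_digraph[of q] by blast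
  qed
  then show ?thesis by blast
qed

text \<open>
  The negation of \<open>linked\<close> relates exactly \<open>Upper\<close> and \<open>Lower\<close>, so its blow-ups are a complete
  bipartite graph plus isolated vertices.
\<close>
lemma iso_complement_bipartite_edgeless_iff:
  assumes "pair_fin_digraph G"
  shows "(\<exists>(C :: nat pair_pre_digraph) (E :: nat pair_pre_digraph).
      K\<^bsub>m,n\<^esub> (with_proj C) \<and> I\<^bsub>q\<^esub> (with_proj E) \<and>
      digraph_iso (with_proj G) (with_proj (graph_complement (C \<uplus> E)))) \<longleftrightarrow>
    blowup_sizes linked (case_level m q n) G"
proof -
  let ?\<C> = "{graph_complement (C \<uplus> E) | (C :: nat pair_pre_digraph) (E :: nat pair_pre_digraph).
    K\<^bsub>m,n\<^esub> (with_proj C) \<and> I\<^bsub>q\<^esub> (with_proj E)}"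
  have "(\<exists>H\<in>?\<C>. digraph_iso (with_proj G) (with_proj H)) \<longleftrightarrow>
    blowup_sizes linked (case_level m q n) G"
  proof (rule iso_to_blowup_class_iff[OF assms])
    fix H assume "H \<in> ?\<C>"
    then obtain C E :: "nat pair_pre_digraph" where H: "H = graph_complement (C \<uplus> E)"
      and "K\<^bsub>m,n\<^esub> (with_proj C)" "I\<^bsub>q\<^esub> (with_proj E)" by blast
    let ?k = "\<lambda>l. (if l = Upper then m else if l = Lower then n else 0) + (if l = Middle then q else 0)"
    have "blowup_sizes (\<lambda>a b. \<not> linked a b) ?k (C \<uplus> E)"
      using \<open>K\<^bsub>m,n\<^esub> (with_proj C)\<close> \<open>I\<^bsub>q\<^esub> (with_proj E)\<close>
      by (intro blowup_sizes_disjoint_union blowup_sizes_complete_bipartite blowup_sizes_edgeless)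
        (auto simp: linked_def split: if_splits)
    from blowup_sizes_complement[OF this] have "blowup_sizes linked ?k H"
      unfolding H by simp
    also have "?k = case_level m q n" by (auto simp: fun_eq_iff split: level.split)
    finally show "blowup_sizes linked (case_level m q n) H" .
  next
    show "?\<C> \<noteq> {}"
      using ex_complete_bipartite_digraph[of m n] ex_edgeless_digraph[of q] by blast
  qed
  then show ?thesis by blast
qed

section \<open>Niche graphs of semiorders\<close>

lemma obtain_extremes:
  fixes f :: "'a \<Rightarrow> real"
  assumes "finite V" "V \<noteq> {}"
  obtains lo hi where "lo \<in> V" "\<And>v. v \<in> V \<Longrightarrow> f lo \<le> f v" "hi \<in> V" "\<And>v. v \<in> V \<Longrightarrow> f v \<le> f hi"
proof (rule that)
  show "arg_min_on f V \<in> V" "arg_min_on (\<lambda>v. - f v) V \<in> V"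
    using assms by (auto intro: arg_min_if_finite(1))
  show "f (arg_min_on f V) \<le> f v" if "v \<in> V" for v
    using arg_min_least[OF assms that, of f] .
  show "f v \<le> f (arg_min_on (\<lambda>v. - f v) V)" if "v \<in> V" for v
    using arg_min_least[OF assms that, of "\<lambda>v. - f v"] by simp
qed

text \<open>
  A vertex of least value is an out-neighbour of every vertex that has an out-neighbour at all, and
  dually for greatest values. So two neighbourhoods of the same kind meet as soon as both are
  nonempty.
\<close>
lemma semiorder_niche_adjacency:
  assumes "finite (pverts D)" "semiorder D" "x \<in> pverts D" "y \<in> pverts D"
  shows "(x, y) \<in> parcs (niche_graph D) \<longleftrightarrow> x \<noteq> y \<and>
    (out_nbrs D x \<noteq> {} \<and> out_nbrs D y \<noteq> {} \<or> in_nbrs D x \<noteq> {} \<and> in_nbrs D y \<noteq> {})"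
proof -
  obtain f :: "'a \<Rightarrow> real" and \<delta> where
    arc: "\<And>u v. u \<in> pverts D \<Longrightarrow> v \<in> pverts D \<Longrightarrow> (u, v) \<in> parcs D \<longleftrightarrow> f u > f v + \<delta>"
    using assms(2) unfolding semiorder_def by auto
  have "pverts D \<noteq> {}" using assms(3) by auto
  then obtain lo hi where lo: "lo \<in> pverts D" "\<And>v. v \<in> pverts D \<Longrightarrow> f lo \<le> f v"
    and hi: "hi \<in> pverts D" "\<And>v. v \<in> pverts D \<Longrightarrow> f v \<le> f hi"
    using obtain_extremes[OF assms(1)] by metis
  have "lo \<in> out_nbrs D v" if "v \<in> pverts D" "out_nbrs D v \<noteq> {}" for v
    using that lo by (fastforce simp: out_nbrs_def arc)
  moreover have "hi \<in> in_nbrs D v" if "v \<in> pverts D" "in_nbrs D v \<noteq> {}" for v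
    using that hi by (fastforce simp: in_nbrs_def arc)
  ultimately have meet: "out_nbrs D x \<inter> out_nbrs D y \<noteq> {} \<longleftrightarrow> out_nbrs D x \<noteq> {} \<and> out_nbrs D y \<noteq> {}"
    "in_nbrs D x \<inter> in_nbrs D y \<noteq> {} \<longleftrightarrow> in_nbrs D x \<noteq> {} \<and> in_nbrs D y \<noteq> {}"
    using assms(3,4) by blast+
  have "(x, y) \<in> parcs (niche_graph D) \<longleftrightarrow> x \<noteq> y \<and>
      (out_nbrs D x \<inter> out_nbrs D y \<noteq> {} \<or> in_nbrs D x \<inter> in_nbrs D y \<noteq> {})"
    using assms(3,4) by (simp add: niche_graph_def)
  then show ?thesis unfolding meet .
qed

fun height :: "level \<Rightarrow> real" where
  "height Upper = 2" | "height Middle = 1" | "height Lower = 0"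

text \<open>
  The heights and \<open>\<delta>\<close> define a semiorder on the vertices of \<open>G\<close>. The hypothesis on \<open>R\<close> is the adjacency
  criterion of \<open>semiorder_niche_adjacency\<close> for that semiorder, expressed through the labels.
\<close>
lemma blowup_is_semiorder_niche_graph:
  fixes G :: "'a pair_pre_digraph" and c :: "'a \<Rightarrow> level" and \<delta> :: real
  assumes "finite (pverts G)" "blowup_of R c G" "\<delta> > 0"
    and R: "\<And>x y. x \<in> pverts G \<Longrightarrow> y \<in> pverts G \<Longrightarrow> R (c x) (c y) \<longleftrightarrow>
      (\<exists>z\<in>pverts G. height (c x) > height (c z) + \<delta>) \<and> (\<exists>z\<in>pverts G. height (c y) > height (c z) + \<delta>) \<or>
      (\<exists>z\<in>pverts G. height (c z) > height (c x) + \<delta>) \<and> (\<exists>z\<in>pverts G. height (c z) > height (c y) + \<delta>)"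
  shows "\<exists>D :: 'a pair_pre_digraph. pair_fin_digraph D \<and> semiorder D \<and> G = niche_graph D"
proof -
  define D :: "'a pair_pre_digraph" where "D = \<lparr>pverts = pverts G,
    parcs = {(x, y) \<in> pverts G \<times> pverts G. height (c x) > height (c y) + \<delta>}\<rparr>"
  have fin: "pair_fin_digraph D"
  proof
    have "parcs D \<subseteq> pverts G \<times> pverts G" by (auto simp: D_def)
    then show "finite (parcs D)" using assms(1) by (meson finite_SigmaI finite_subset)
  qed (use assms(1) in \<open>auto simp: D_def\<close>)
  have semi: "semiorder D"
    unfolding semiorder_def
    by (rule exI[of _ "height \<circ> c"], rule exI[of _ \<delta>]) (simp add: assms(3) D_def)
  have nbrs: "out_nbrs D x \<noteq> {} \<longleftrightarrow> (\<exists>z\<in>pverts G. height (c x) > height (c z) + \<delta>)"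
    "in_nbrs D x \<noteq> {} \<longleftrightarrow> (\<exists>z\<in>pverts G. height (c z) > height (c x) + \<delta>)" if "x \<in> pverts G" for x
    using that by (auto simp: out_nbrs_def in_nbrs_def D_def)
  have "(x, y) \<in> parcs G \<longleftrightarrow> (x, y) \<in> parcs (niche_graph D)" for x y
  proof (cases "x \<in> pverts G \<and> y \<in> pverts G")
    case True
    then have xy: "x \<in> pverts D" "y \<in> pverts D" by (auto simp: D_def)
    have "(x, y) \<in> parcs G \<longleftrightarrow> x \<noteq> y \<and> R (c x) (c y)"
      using True assms(2) by (simp add: blowup_of_def)
    also have "\<dots> \<longleftrightarrow> (x, y) \<in> parcs (niche_graph D)"
      using semiorder_niche_adjacency[OF _ semi xy] assms(1) True R[of x y] nbrs[of x] nbrs[of y]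
      by (simp add: D_def)
    finally show ?thesis .
  next
    case False
    then show ?thesis using assms(2) by (auto simp: blowup_of_def niche_graph_def D_def)
  qed
  then have "parcs G = parcs (niche_graph D)" by auto
  then have "G = niche_graph D" by (intro pair_pre_digraph.equality) (auto simp: niche_graph_def D_def)
  with fin semi show ?thesis by blast
qed

text \<open>
  The two alternatives correspond to whether some vertex has both out-neighbours and
  in-neighbours. In the first the two cliques are disjoint, and they are empty only together, as an
  arc creates a member of each. In the second such a vertex forces the two cliques to cover
  everything, and each of them has a vertex outside the other.
\<close>
lemma semiorder_niche_graph_is_blowup:
  fixes D :: "'a pair_pre_digraph"
  assumes "finite (pverts D)" "semiorder D"
  defines "G \<equiv> niche_graph D"
  shows "(\<exists>c. blowup_of clustered c G \<and> (fibre c G Upper = {} \<longleftrightarrow> fibre c G Lower = {})) \<or>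
    (\<exists>c. blowup_of linked c G \<and> (\<forall>l. fibre c G l \<noteq> {}))"
proof -
  obtain f :: "'a \<Rightarrow> real" and \<delta> where \<delta>: "\<delta> > 0" and
    arc: "\<And>u v. u \<in> pverts D \<Longrightarrow> v \<in> pverts D \<Longrightarrow> (u, v) \<in> parcs D \<longleftrightarrow> f u > f v + \<delta>"
    using assms(2) unfolding semiorder_def by auto
  define out where "out v \<longleftrightarrow> out_nbrs D v \<noteq> {}" for v
  define inn where "inn v \<longleftrightarrow> in_nbrs D v \<noteq> {}" for v
  define c where "c v = (if out v \<and> \<not> inn v then Upper
    else if inn v \<and> \<not> out v then Lower else Middle)" for v
  have c_iff: "c v = Upper \<longleftrightarrow> out v \<and> \<not> inn v" "c v = Lower \<longleftrightarrow> inn v \<and> \<not> out v"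
    "c v = Middle \<longleftrightarrow> (out v \<longleftrightarrow> inn v)" for v
    by (auto simp: c_def)
  have pverts_G: "pverts G = pverts D" by (simp add: G_def niche_graph_def)
  have "parcs G \<subseteq> pverts D \<times> pverts D" by (auto simp: G_def niche_graph_def)
  then have arcs_G: "parcs G = {(x, y). x \<in> pverts D \<and> y \<in> pverts D \<and> x \<noteq> y \<and>
      (out x \<and> out y \<or> inn x \<and> inn y)}"
    using semiorder_niche_adjacency[OF assms(1,2)] unfolding G_def out_def inn_def by auto
  have out_iff: "out v \<longleftrightarrow> (\<exists>u\<in>pverts D. f v > f u + \<delta>)"
    and inn_iff: "inn v \<longleftrightarrow> (\<exists>u\<in>pverts D. f u > f v + \<delta>)" if "v \<in> pverts D" for v
    using that by (auto simp: out_def inn_def out_nbrs_def in_nbrs_def arc)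
  \<comment> \<open>With at least one arc, the extreme values are more than \<open>\<delta>\<close> apart, so the top vertex has an
    out-neighbour and the bottom vertex an in-neighbour; being extreme, they have none of the
    other kind.\<close>
  have ex_source: "\<exists>w\<in>pverts D. out w \<and> \<not> inn w" and ex_sink: "\<exists>w\<in>pverts D. inn w \<and> \<not> out w"
    if "u \<in> pverts D" "v \<in> pverts D" "f u > f v + \<delta>" for u v
  proof -
    have "pverts D \<noteq> {}" using that(1) by auto
    then obtain lo hi where lo: "lo \<in> pverts D" "\<And>v. v \<in> pverts D \<Longrightarrow> f lo \<le> f v"
      and hi: "hi \<in> pverts D" "\<And>v. v \<in> pverts D \<Longrightarrow> f v \<le> f hi"
      using obtain_extremes[OF assms(1)] by metis
    have "f hi > f lo + \<delta>" using that lo(2)[of v] hi(2)[of u] by linarith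
    then have "out hi" "inn lo" using lo(1) hi(1) by (auto simp: out_iff inn_iff)
    moreover have "\<not> inn hi" using hi \<delta> by (fastforce simp: inn_iff)
    moreover have "\<not> out lo" using lo \<delta> by (fastforce simp: out_iff)
    ultimately show "\<exists>w\<in>pverts D. out w \<and> \<not> inn w" "\<exists>w\<in>pverts D. inn w \<and> \<not> out w"
      using lo(1) hi(1) by auto
  qed
  show ?thesis
  proof (cases "\<exists>z\<in>pverts D. out z \<and> inn z")
    case False
    have "blowup_of clustered c G"
      using False unfolding blowup_of_def arcs_G pverts_G clustered_iff c_iff by blast
    moreover have "fibre c G Upper = {} \<longleftrightarrow> fibre c G Lower = {}"
    proof -
      have "(\<exists>v\<in>pverts D. out v \<and> \<not> inn v) \<longleftrightarrow> (\<exists>v\<in>pverts D. inn v \<and> \<not> out v)"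
        by (meson out_iff inn_iff ex_source ex_sink)
      then show ?thesis unfolding fibre_def pverts_G c_iff by blast
    qed
    ultimately show ?thesis by blast
  next
    case True
    then obtain z u v where z: "z \<in> pverts D" "out z" "inn z" and uv: "u \<in> pverts D" "v \<in> pverts D"
      and "f z > f v + \<delta>" "f u > f z + \<delta>" using out_iff inn_iff by blast
    \<comment> \<open>A vertex above \<open>z\<close> dominates \<open>v\<close>, and any other vertex is dominated by \<open>u\<close>.\<close>
    have cover: "out x \<or> inn x" if "x \<in> pverts D" for x
    proof (cases "f x > f z")
      case True
      then have "f x > f v + \<delta>" using \<open>f z > f v + \<delta>\<close> by linarith
      then show ?thesis using out_iff[OF that] uv(2) by blast
    next
      case False
      then have "f u > f x + \<delta>" using \<open>f u > f z + \<delta>\<close> by linarith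
      then show ?thesis using inn_iff[OF that] uv(1) by blast
    qed
    have "blowup_of linked c G"
      using cover unfolding blowup_of_def arcs_G pverts_G linked_iff c_iff by blast
    moreover have "\<forall>l. fibre c G l \<noteq> {}"
      using ex_source[OF z(1) uv(2)] ex_sink[OF z(1) uv(2)] \<open>f z > f v + \<delta>\<close> z
      unfolding all_level fibre_def pverts_G c_iff by blast
    ultimately show ?thesis by blast
  qed
qed

theorem theorem3:
  fixes G :: "'a pair_pre_digraph"
  assumes "pair_graph G" and "pverts G \<noteq> {}"
  shows "(\<exists>D :: 'a pair_pre_digraph. pair_fin_digraph D \<and> semiorder D \<and> G = niche_graph D) \<longleftrightarrow>
    (\<exists>q>0. \<exists>E :: nat pair_pre_digraph.
        I\<^bsub>q\<^esub> (with_proj E) \<and>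
        digraph_iso (with_proj G) (with_proj E)) \<or>
    (\<exists>m>0. \<exists>n>0. \<exists>(A :: nat pair_pre_digraph) (B :: nat pair_pre_digraph).
        K\<^bsub>m\<^esub> (with_proj A) \<and> K\<^bsub>n\<^esub> (with_proj B) \<and>
        digraph_iso (with_proj G) (with_proj (A \<uplus> B))) \<or>
    (\<exists>m>0. \<exists>n>0. \<exists>q>0. \<exists>(A :: nat pair_pre_digraph) (B :: nat pair_pre_digraph) (E :: nat pair_pre_digraph).
        K\<^bsub>m\<^esub> (with_proj A) \<and> K\<^bsub>n\<^esub> (with_proj B) \<and> I\<^bsub>q\<^esub> (with_proj E) \<and>
        digraph_iso (with_proj G) (with_proj (A \<uplus> B \<uplus> E))) \<or>
    (\<exists>m>0. \<exists>n>0. \<exists>q>0. \<exists>(C :: nat pair_pre_digraph) (E :: nat pair_pre_digraph).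
        K\<^bsub>m,n\<^esub> (with_proj C) \<and> I\<^bsub>q\<^esub> (with_proj E) \<and>
        digraph_iso (with_proj G) (with_proj (graph_complement (C \<uplus> E))))"
proof -
  have fin: "pair_fin_digraph G" using assms(1) by (simp add: pair_graph_def pair_digraph_def)
  then interpret pair_fin_digraph G .
  have card_fibre: "card (fibre c G l) > 0 \<longleftrightarrow> fibre c G l \<noteq> {}"
      "card (fibre c G l) = 0 \<longleftrightarrow> fibre c G l = {}" for c :: "'a \<Rightarrow> level" and l
    using pair_finite_verts by (auto simp: fibre_def card_gt_0_iff)
  have sizes: "blowup_sizes R k G \<longleftrightarrow> (\<exists>c. blowup_of R c G \<and> (\<forall>l. card (fibre c G l) = k l))"
    for R and k :: "level \<Rightarrow> nat"
    using pair_finite_verts by (simp add: blowup_sizes_def)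
  have clustered_if: "\<exists>D :: 'a pair_pre_digraph. pair_fin_digraph D \<and> semiorder D \<and> G = niche_graph D"
    if "blowup_of clustered c G" "fibre c G Upper = {} \<longleftrightarrow> fibre c G Lower = {}" for c
  proof (rule blowup_is_semiorder_niche_graph[OF pair_finite_verts that(1), of 1])
    \<comment> \<open>With threshold \<open>1\<close> a single step down is not an arc, which keeps \<open>Middle\<close> isolated.\<close>
    have above: "height a > height b + 1 \<longleftrightarrow> a = Upper \<and> b = Lower" for a b
      by (cases a; cases b) auto
    show "clustered (c x) (c y) \<longleftrightarrow>
      (\<exists>z\<in>pverts G. height (c x) > height (c z) + 1) \<and> (\<exists>z\<in>pverts G. height (c y) > height (c z) + 1) \<or>
      (\<exists>z\<in>pverts G. height (c z) > height (c x) + 1) \<and> (\<exists>z\<in>pverts G. height (c z) > height (c y) + 1)"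
      if "x \<in> pverts G" "y \<in> pverts G" for x y
      using that \<open>fibre c G Upper = {} \<longleftrightarrow> fibre c G Lower = {}\<close>
      unfolding above clustered_def fibre_def by (cases "c x"; cases "c y") auto
  qed simp
  have linked_if: "\<exists>D :: 'a pair_pre_digraph. pair_fin_digraph D \<and> semiorder D \<and> G = niche_graph D"
    if "blowup_of linked c G" "\<forall>l. fibre c G l \<noteq> {}" for c
  proof (rule blowup_is_semiorder_niche_graph[OF pair_finite_verts that(1), of "1 / 2"])
    have all_levels: "c ` pverts G = UNIV"
      using that(2) unfolding fibre_def by (auto simp: image_iff) metis
    \<comment> \<open>All levels are inhabited, so a neighbour can be looked for among the levels themselves.\<close>
    have ex: "(\<exists>z\<in>pverts G. P (c z)) \<longleftrightarrow> P Upper \<or> P Middle \<or> P Lower" for P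
    proof -
      have "(\<exists>z\<in>pverts G. P (c z)) \<longleftrightarrow> (\<exists>l. P l)" using all_levels by (metis UNIV_I image_iff)
      then show ?thesis using all_level[of "\<lambda>l. \<not> P l"] by blast
    qed
    have dominates: "(\<exists>z\<in>pverts G. height a > height (c z) + 1 / 2) \<longleftrightarrow> a \<noteq> Lower"
      and dominated: "(\<exists>z\<in>pverts G. height (c z) > height a + 1 / 2) \<longleftrightarrow> a \<noteq> Upper" for a
      using ex[of "\<lambda>l. height a > height l + 1 / 2"] ex[of "\<lambda>l. height l > height a + 1 / 2"]
      by (cases a; simp)+
    show "linked (c x) (c y) \<longleftrightarrow>
      (\<exists>z\<in>pverts G. height (c x) > height (c z) + 1 / 2) \<and> (\<exists>z\<in>pverts G. height (c y) > height (c z) + 1 / 2) \<or>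
      (\<exists>z\<in>pverts G. height (c z) > height (c x) + 1 / 2) \<and> (\<exists>z\<in>pverts G. height (c z) > height (c y) + 1 / 2)"
      for x y
      unfolding dominates dominated linked_iff by (cases "c x"; cases "c y") simp_all
  qed simp
  have "(\<exists>D :: 'a pair_pre_digraph. pair_fin_digraph D \<and> semiorder D \<and> G = niche_graph D) \<longleftrightarrow>
    (\<exists>c. blowup_of clustered c G \<and> (fibre c G Upper = {} \<longleftrightarrow> fibre c G Lower = {})) \<or>
    (\<exists>c. blowup_of linked c G \<and> (\<forall>l. fibre c G l \<noteq> {}))"
    using clustered_if linked_if semiorder_niche_graph_is_blowup pair_fin_digraph.pair_finite_verts
    by blast
  also have "(\<exists>c. blowup_of linked c G \<and> (\<forall>l. fibre c G l \<noteq> {})) \<longleftrightarrow>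
    (\<exists>m>0. \<exists>n>0. \<exists>q>0. blowup_sizes linked (case_level m q n) G)"
    unfolding sizes card_fibre(1)[symmetric] all_level level.case by blast
  also have "(\<exists>c. blowup_of clustered c G \<and> (fibre c G Upper = {} \<longleftrightarrow> fibre c G Lower = {})) \<longleftrightarrow>
    (\<exists>q>0. blowup_sizes clustered (case_level 0 q 0) G) \<or>
    (\<exists>m>0. \<exists>n>0. blowup_sizes clustered (case_level m 0 n) G) \<or>
    (\<exists>m>0. \<exists>n>0. \<exists>q>0. blowup_sizes clustered (case_level m q n) G)"
    (is "(\<exists>c. ?B c) \<longleftrightarrow> ?R")
  proof
    assume "\<exists>c. ?B c"
    then obtain c where c: "blowup_of clustered c G" "card (fibre c G Upper) = 0 \<longleftrightarrow> card (fibre c G Lower) = 0"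
      unfolding card_fibre(2) by blast
    \<comment> \<open>If both cliques are empty, \<open>q > 0\<close> holds in the edgeless family because \<open>G\<close> has a vertex.\<close>
    have "card (fibre c G Middle) > 0" if "card (fibre c G Upper) = 0" "card (fibre c G Lower) = 0"
    proof -
      obtain x where "x \<in> pverts G" using assms(2) by blast
      then have "x \<in> fibre c G Middle"
        using that unfolding card_fibre(2) by (cases "c x") (auto simp: fibre_def)
      then show ?thesis unfolding card_fibre(1) by blast
    qed
    with c show ?R unfolding sizes all_level level.case by (metis gr0I)
  next
    assume ?R
    then obtain c where "blowup_of clustered c G"
      "card (fibre c G Upper) = 0 \<and> card (fibre c G Lower) = 0 \<or>
       card (fibre c G Upper) > 0 \<and> card (fibre c G Lower) > 0"
      unfolding sizes all_level level.case by blast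
    then have "?B c" unfolding card_fibre by blast
    then show "\<exists>c. ?B c" by blast
  qed
  finally show ?thesis
    unfolding iso_edgeless_iff[OF fin] iso_two_completes_iff[OF fin]
      iso_two_completes_edgeless_iff[OF fin] iso_complement_bipartite_edgeless_iff[OF fin]
    by (simp only: disj_assoc)
qed

end
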